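(* If $\mathcal{A}$ is an infinite alphabet and $X$ is a shift of finite type over $\mathcal{A}$, then $X$ is not row-finite.
   Context: Let $\mathcal{A}$ be an infinite set (alphabet), $\mathcal{A}^0=\{\vec{0}\}$ ($\vec{0}$ the empty sequence), $\Sigma_{\mathcal{A}}^{\mathrm{fin}}=\bigcup_{k=0}^\infty\mathcal{A}^k$ (blocks), $\Sigma_{\mathcal{A}}^{\mathrm{inf}}=\mathcal{A}^{\mathbb{N}}$ with $\mathbb{N}=\{1,2,\ldots\}$, and $\Sigma_{\mathcal{A}}:=\Sigma_{\mathcal{A}}^{\mathrm{inf}}\sqcup\Sigma_{\mathcal{A}}^{\mathrm{fin}}$. A subblock of a sequence $x$ is a finite block $u$ with $x=yuz$ for some finite sequence $y$ and some sequence $z$; $\vec{0}$ is a subblock of every sequence. For $\mathcal{F}\subseteq\Sigma_{\mathcal{A}}^{\mathrm{fin}}$: $X^{\mathrm{inf}}_{\mathcal{F}}:=\{x\in\Sigma_{\mathcal{A}}^{\mathrm{inf}}:\text{no subblock of }x\text{ is in }\mathcal{F}\}$, $X^{\mathrm{fin}}_{\mathcal{F}}:=\{x\in\Sigma_{\mathcal{A}}^{\mathrm{fin}}:\text{there are infinitely many }a\in\mathcal{A}\text{ for which there exists }y\in\Sigma_{\mathcal{A}}^{\mathrm{inf}}\text{ with }xay\in X^{\mathrm{inf}}_{\mathcal{F}}\}$, and $X_{\mathcal{F}}:=X^{\mathrm{inf}}_{\mathcal{F}}\cup X^{\mathrm{fin}}_{\mathcal{F}}$ (such sets are shift spaces over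 $\mathcal{A}$). A shift of finite type over $\mathcal{A}$ is a set $X\subseteq\Sigma_{\mathcal{A}}$ of the form $X=X_{\mathcal{F}}$ for some finite set $\mathcal{F}\subseteq\Sigma_{\mathcal{A}}^{\mathrm{fin}}$. Let $B(X)$ be the set of all finite blocks that are subblocks of elements of $X$. $X$ is row-finite if for every $a\in\mathcal{A}$ the set $\{b\in\mathcal{A}:ab\in B(X)\}$ is finite.
   Formalization: The shift of finite type X is additionally assumed to be nonempty; if the empty block is forbidden, X is empty and vacuously row-finite, so the claim fails for it. *)

theory Defs
  imports Main "HOL-Library.Stream"
begin

text \<open>
  The alphabet is a set \<open>A\<close>. Blocks over \<open>A\<close> are the elements of \<open>lists A\<close>, infinite sequences over
  \<open>A\<close> the elements of \<open>streams A\<close>; the datatype is the disjoint union of the two kinds of sequences.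
\<close>

datatype 'a sequence = InfSeq "'a stream" | FinSeq "'a list"

definition full_shift :: "'a set \<Rightarrow> 'a sequence set" where
  "full_shift A = InfSeq ` streams A \<union> FinSeq ` lists A"

fun cat :: "'a list \<Rightarrow> 'a sequence \<Rightarrow> 'a sequence" where
  "cat u (InfSeq z) = InfSeq (u @- z)"
| "cat u (FinSeq z) = FinSeq (u @ z)"

text \<open>
  If \<open>x\<close> is a sequence over \<open>A\<close>, then \<open>y\<close>, \<open>u\<close> and \<open>z\<close> below are automatically over \<open>A\<close>.
\<close>

definition subblock :: "'a list \<Rightarrow> 'a sequence \<Rightarrow> bool" where
  "subblock u x \<longleftrightarrow> (\<exists>y z. x = cat y (cat u z))"

definition X_inf :: "'a set \<Rightarrow> 'a list set \<Rightarrow> 'a sequence set" where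
  "X_inf A F = {x \<in> InfSeq ` streams A. \<forall>u. subblock u x \<longrightarrow> u \<notin> F}"

definition X_fin :: "'a set \<Rightarrow> 'a list set \<Rightarrow> 'a sequence set" where
  "X_fin A F =
     {FinSeq x |x. x \<in> lists A \<and>
        infinite {a \<in> A. \<exists>y \<in> streams A. cat x (cat [a] (InfSeq y)) \<in> X_inf A F}}"

definition shift_space :: "'a set \<Rightarrow> 'a list set \<Rightarrow> 'a sequence set" where
  "shift_space A F = X_inf A F \<union> X_fin A F"

definition shift_of_finite_type :: "'a set \<Rightarrow> 'a sequence set \<Rightarrow> bool" where
  "shift_of_finite_type A X \<longleftrightarrow>
     X \<subseteq> full_shift A \<and> (\<exists>F. finite F \<and> F \<subseteq> lists A \<and> X = shift_space A F)"

definition blocks :: "'a sequence set \<Rightarrow> 'a list set" where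
  "blocks X = {u. \<exists>x \<in> X. subblock u x}"

definition row_finite :: "'a set \<Rightarrow> 'a sequence set \<Rightarrow> bool" where
  "row_finite A X \<longleftrightarrow> (\<forall>a \<in> A. finite {b \<in> A. [a, b] \<in> blocks X})"

end

theory Submission imports Defs begin

text \<open>
  Only finitely many letters occur in a finite set of forbidden blocks. For letters \<open>a\<close> and \<open>b\<close>
  outside this finite set, the sequence \<open>abbb\<dots>\<close> contains no forbidden block, so \<open>ab\<close> is allowed;
  hence every such \<open>a\<close> has infinitely many followers.
\<close>

lemma set_subset_sset_if_subblock:
  assumes "subblock u (InfSeq s)"
  shows "set u \<subseteq> sset s"
proof -
  obtain y z where "InfSeq s = cat y (cat u z)"
    using assms unfolding subblock_def by blast
  \<comment> \<open>A finite \<open>z\<close> would make the right-hand side a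
    \<open>FinSeq\<close>, so only an infinite \<open>z\<close> remains.\<close>
  then show ?thesis by (cases z) auto
qed

lemma subblock_Nil: "subblock [] x"
proof -
  have "cat [] w = w" for w :: "'a sequence" by (cases w) auto
  then show ?thesis unfolding subblock_def by metis
qed

text \<open>The empty block is a subblock of every sequence, so forbidding it leaves
  nothing.\<close>

lemma Nil_notin_forbidden:
  assumes "shift_space A F \<noteq> {}"
  shows "[] \<notin> F"
proof
  assume "[] \<in> F"
  then have "X_inf A F = {}"
    unfolding X_inf_def using subblock_Nil by blast
  \<comment> \<open>With \<open>X_inf A F\<close> empty, no letter extends a finite block, so
    \<open>X_fin A F\<close> is empty too.\<close>
  then have "shift_space A F = {}"
    by (simp add: shift_space_def X_fin_def)
  with assms show False ..
qed

text \<open>A nonempty forbidden block occurring in \<open>s\<close> would put its first letter into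
  \<open>sset s\<close>; the empty block has no letter to detect it by.\<close>

lemma InfSeq_in_X_inf_if_avoids_letters:
  assumes "[] \<notin> F" and "s \<in> streams A" and "sset s \<inter> (\<Union>u\<in>F. set u) = {}"
  shows "InfSeq s \<in> X_inf A F"
proof -
  have "u \<notin> F" if "subblock u (InfSeq s)" for u
  proof
    assume "u \<in> F"
    with assms(1) have "u \<noteq> []" by blast
    then have "hd u \<in> set u" by simp
    with set_subset_sset_if_subblock[OF that] \<open>u \<in> F\<close> assms(3) show False
      by blast
  qed
  with assms(2) show ?thesis unfolding X_inf_def by blast
qed

theorem proposition6p1:
  fixes A :: "'a set" and X :: "'a sequence set"
  assumes "infinite A"
    and "shift_of_finite_type A X"
    and "X \<noteq> {}"
  shows "\<not> row_finite A X"
proof -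
  obtain F where F: "finite F" "X = shift_space A F"
    using assms(2) unfolding shift_of_finite_type_def by blast
  define L where "L = (\<Union>u\<in>F. set u)"
  have "finite L" using F(1) by (simp add: L_def)
  then have inf: "infinite (A - L)" using assms(1) by (rule Diff_infinite_finite)
  then obtain a where a: "a \<in> A - L" using infinite_imp_nonempty by blast
  have "[a, b] \<in> blocks X" if b: "b \<in> A - L" for b
  proof -
    have "InfSeq (a ## sconst b) \<in> X_inf A F"
    proof (rule InfSeq_in_X_inf_if_avoids_letters)
      show "[] \<notin> F" using Nil_notin_forbidden assms(3) F(2) by blast
      show "a ## sconst b \<in> streams A" using a b by (auto simp: streams_iff_sset)
      show "sset (a ## sconst b) \<inter> (\<Union>u\<in>F. set u) = {}" using a b by (auto simp: L_def)
    qed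
    \<comment> \<open>Unrolling one \<open>b\<close> from the constant stream exhibits
      \<open>[a, b]\<close> as a subblock with empty prefix.\<close>
    moreover have "InfSeq (a ## sconst b) = cat [] (cat [a, b] (InfSeq (sconst b)))"
      by (simp, metis id_apply siterate.code)
    ultimately show ?thesis
      unfolding blocks_def subblock_def F(2) shift_space_def by blast
  qed
  then have "A - L \<subseteq> {b \<in> A. [a, b] \<in> blocks X}" by blast
  with inf have "infinite {b \<in> A. [a, b] \<in> blocks X}" using finite_subset by blast
  with a show ?thesis unfolding row_finite_def by blast
qed

end
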